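(* Let $X$ be the Cantor set, let $U,V\subset X$ be open sets such that $X_U:=X\setminus U$ and $X_V:=X\setminus V$ are nonempty, finite and disjoint from each other, and let $h:U\to V$ be a minimal homeomorphism. Suppose that $\{\mathcal P_n\}_{n\ge0}$ and $\{\mathcal Q_n\}_{n\ge0}$ are two admissible sequences of Kakutani-Rokhlin partitions for $(X,h)$. Then the ordered Bratteli diagrams constructed from $\{\mathcal P_n\}_{n\ge0}$ and from $\{\mathcal Q_n\}_{n\ge0}$ are equivalent.
   Context: **Minimality.** For a homeomorphism $h:U\to V$ between open subsets of $X$, the iterates $h^n$ ($n\in\mathbb Z$) are taken on their natural domains: $h^0=\mathrm{id}_X$; for $n\ge1$, $\mathrm{dom}(h^n)$ is the set of $x$ with $x,h(x),\dots,h^{n-1}(x)\in U$; and $h^{-n}=(h^{-1})^n$. The orbit of $x\in X$ is $O(x)=\{h^n(x)\mid n\in\mathbb Z,\ h^n(x)\text{ is defined}\}$, and $h$ is *minimal* if $O(x)$ is dense in $X$ for every $x\in X$. $(X,h)$ denotes the induced partial action of $\mathbb Z$. **Kakutani-Rokhlin partitions.** A Kakutani-Rokhlin partition for $(X,h)$ is a partition $\{E(k,j)\mid 1\le k\le K,\ 1\le j\le J(k)\}$ of $X$ into (nonempty) clopen sets, with $K,J(1),\dots,J(K)$ positive integers, such that: (1) $X_U\subset\bigcup_k E(k,J(k))$ and $X_V\subset\bigcup_k E(k,1)$; (2) $h(E(k,j))=E(k,j+1)$ for $1\le k\le K$, $1\le j<J(k)$; (3) $\bigcup_k h(E(k,J(k))\setminus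 X_U)\cup X_V=\bigcup_k E(k,1)$. **Admissible sequences.** Call a sequence of Kakutani-Rokhlin partitions $\mathcal P_n=\{E(n,k,j)\mid 1\le k\le K_n,\ 1\le j\le J(n,k)\}$, $n\ge0$, *admissible* if $\mathcal P_0=\{X\}$ (that is, $K_0=1$, $J(0,1)=1$, $E(0,1,1)=X$) and: (i) $\{\bigcup_{k=1}^{K_n}E(n,k,1)\}_{n\ge0}$ is a decreasing sequence of clopen sets with intersection $X_V$; (ii) $\mathcal P_{n+1}$ is finer than $\mathcal P_n$ for all $n\geq 0$; (iii) $\bigcup_n\mathcal P_n$ generates the topology of $X$. **Bratteli diagrams.** A Bratteli diagram $(V,E)$ is an infinite directed graph with vertex set $V=\bigsqcup_{n\ge0}V_n$ and edge set $E=\bigsqcup_{n\ge1}E_n$, all $V_n,E_n$ finite and nonempty, $V_0=\{v_0\}$ a single vertex, with range and source maps $r,s:E\to V$ satisfying $r(E_n)=V_n$, $s(E_n)=V_{n-1}$, with $s^{-1}(v)\ne\emptyset$ for all $v\in V$ and $r^{-1}(v)\neq\emptyset$ for all $v\in V\setminus V_0$. An ordered Bratteli diagram $(V,E,\ge)$ carries in addition a partial order on $E$ in which two edges $e,e'$ are comparable if and only if $r(e)=r(e')$. (The vertex set is unrelated to the open set $V\subset X$.) **Diagram constructed from an admissible sequence.** Put $V_n=\{(n,1),\dots,(n,K_n)\}$ for $n\ge0$, and for $n\ge1$ let $E_n$ be the set of all $(n,m,k,j')$ with $1\le m\le K_{n-1}$, $1\le k\le K_n$, $j'\ge0$, $j'+J(n-1,m)\le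 J(n,k)$ and $E(n,k,j+j')\subset E(n-1,m,j)$ for all $1\le j\le J(n-1,m)$. Set $r(n,m,k,j')=(n,k)$, $s(n,m,k,j')=(n-1,m)$, and $(n,m_1,k,j_1)\ge(n,m_2,k,j_2)$ iff $j_1\ge j_2$. This is an ordered Bratteli diagram. **Equivalence.** For $l>k\ge0$ let $P_{k,l}$ be the set of paths $e_{k+1}e_{k+2}\cdots e_l$ with $e_i\in E_i$ and $r(e_i)=s(e_{i+1})$; the range of such a path is $r(e_l)$ and its source is $s(e_{k+1})$. Paths in $P_{k,l}$ with the same range are linearly ordered lexicographically from the range end: $e_{k+1}\cdots e_l>f_{k+1}\cdots f_l$ iff for some $i$ one has $e_j=f_j$ for all $i<j\le l$ and $e_i>f_i$. Given a strictly increasing sequence $(m_n)_{n\ge0}$ of nonnegative integers with $m_0=0$, the *contraction* of $(V,E,\ge)$ to $(m_n)$ is the ordered Bratteli diagram with $V_n'=V_{m_n}$, $E_n'=P_{m_{n-1},m_n}$, in which a path $e_{m_{n-1}+1}\cdots e_{m_n}\in E_n'$ has range $r(e_{m_n})$ and source $s(e_{m_{n-1}+1})$, and in which paths in $E_n'$ with the same range are ordered lexicographically from the range end. Two ordered Bratteli diagrams are *isomorphic* if there are bijections between their vertex sets and between their edge sets that preserve the gradings, intertwine the range and source maps, and preserve the order of edges. *Equivalence* of ordered Bratteli diagrams is the equivalence relation generated by isomorphism and contraction. *)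

theory Defs
  imports "HOL-Analysis.Analysis" "HOL-Library.Disjoint_Sets"
begin

section \<open>Partial homeomorphisms and minimality\<close>

definition cantor_space :: "'a topology \<Rightarrow> bool" where
  "cantor_space X \<longleftrightarrow>
     X homeomorphic_space product_topology (\<lambda>_::nat. discrete_topology (UNIV :: bool set)) UNIV"

text \<open>A map \<open>h : U \<rightarrow> V\<close> is a total HOL function of which only the values on \<open>U\<close> are
  relevant; its iterates are used only on their natural domains.\<close>

definition iter_dom_nat :: "'a topology \<Rightarrow> 'a set \<Rightarrow> ('a \<Rightarrow> 'a) \<Rightarrow> nat \<Rightarrow> 'a set" where
  "iter_dom_nat X U h n = {x \<in> topspace X. \<forall>i<n. (h ^^ i) x \<in> U}"

definition iter_dom :: "'a topology \<Rightarrow> 'a set \<Rightarrow> 'a set \<Rightarrow> ('a \<Rightarrow> 'a) \<Rightarrow> int \<Rightarrow> 'a set" where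
  "iter_dom X U V h n =
     (if 0 \<le> n then iter_dom_nat X U h (nat n) else iter_dom_nat X V (inv_into U h) (nat (- n)))"

definition iter :: "'a set \<Rightarrow> ('a \<Rightarrow> 'a) \<Rightarrow> int \<Rightarrow> 'a \<Rightarrow> 'a" where
  "iter U h n = (if 0 \<le> n then h ^^ nat n else inv_into U h ^^ nat (- n))"

definition orbit :: "'a topology \<Rightarrow> 'a set \<Rightarrow> 'a set \<Rightarrow> ('a \<Rightarrow> 'a) \<Rightarrow> 'a \<Rightarrow> 'a set" where
  "orbit X U V h x = {iter U h n x | n. x \<in> iter_dom X U V h n}"

definition minimal :: "'a topology \<Rightarrow> 'a set \<Rightarrow> 'a set \<Rightarrow> ('a \<Rightarrow> 'a) \<Rightarrow> bool" where
  "minimal X U V h \<longleftrightarrow> (\<forall>x \<in> topspace X. X closure_of orbit X U V h x = topspace X)"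


section \<open>Kakutani-Rokhlin partitions\<close>

text \<open>The fields are \<open>K\<close>, \<open>J\<close> and \<open>E\<close>. Only \<open>J k\<close> with \<open>1 \<le> k \<le> K\<close> and \<open>E k j\<close> with moreover
  \<open>1 \<le> j \<le> J k\<close> carry information.\<close>

record 'a kr =
  towers :: nat
  height :: "nat \<Rightarrow> nat"
  cell :: "nat \<Rightarrow> nat \<Rightarrow> 'a set"

definition kr_index :: "'a kr \<Rightarrow> (nat \<times> nat) set" where
  "kr_index P = (SIGMA k : {1..towers P}. {1..height P k})"

definition kr_cells :: "'a kr \<Rightarrow> 'a set set" where
  "kr_cells P = (\<lambda>(k, j). cell P k j) ` kr_index P"

definition kr_base :: "'a kr \<Rightarrow> 'a set" where
  "kr_base P = (\<Union>k \<in> {1..towers P}. cell P k 1)"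

definition kr_top :: "'a kr \<Rightarrow> 'a set" where
  "kr_top P = (\<Union>k \<in> {1..towers P}. cell P k (height P k))"

text \<open>Injectivity of the indexing says that distinct pairs \<open>(k, j)\<close> index distinct, hence disjoint,
  members of the partition.\<close>

definition kr_partition ::
    "'a topology \<Rightarrow> 'a set \<Rightarrow> 'a set \<Rightarrow> ('a \<Rightarrow> 'a) \<Rightarrow> 'a kr \<Rightarrow> bool" where
  "kr_partition X U V h P \<longleftrightarrow>
     0 < towers P \<and> (\<forall>k \<in> {1..towers P}. 0 < height P k) \<and>
     partition_on (topspace X) (kr_cells P) \<and>
     inj_on (\<lambda>(k, j). cell P k j) (kr_index P) \<and>
     (\<forall>C \<in> kr_cells P. openin X C \<and> closedin X C) \<and>
     topspace X - U \<subseteq> kr_top P \<and> topspace X - V \<subseteq> kr_base P \<and>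
     (\<forall>k \<in> {1..towers P}. \<forall>j. 1 \<le> j \<and> j < height P k \<longrightarrow> h ` cell P k j = cell P k (j + 1)) \<and>
     (\<Union>k \<in> {1..towers P}. h ` (cell P k (height P k) - (topspace X - U))) \<union> (topspace X - V)
       = kr_base P"

definition admissible ::
    "'a topology \<Rightarrow> 'a set \<Rightarrow> 'a set \<Rightarrow> ('a \<Rightarrow> 'a) \<Rightarrow> (nat \<Rightarrow> 'a kr) \<Rightarrow> bool" where
  "admissible X U V h P \<longleftrightarrow>
     (\<forall>n. kr_partition X U V h (P n)) \<and>
     towers (P 0) = 1 \<and> height (P 0) 1 = 1 \<and> cell (P 0) 1 1 = topspace X \<and>
     decseq (\<lambda>n. kr_base (P n)) \<and>
     (\<forall>n. openin X (kr_base (P n)) \<and> closedin X (kr_base (P n))) \<and>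
     (\<Inter>n. kr_base (P n)) = topspace X - V \<and>
     (\<forall>n. refines (topspace X) (kr_cells (P (Suc n))) (kr_cells (P n))) \<and>
     topology_generated_by (\<Union>n. kr_cells (P n)) = X"


section \<open>Ordered Bratteli diagrams\<close>

text \<open>\<open>verts n\<close> is \<open>V\<^sub>n\<close> and \<open>edges n\<close> is \<open>E\<^sub>n\<close>. The edge sets are indexed from \<open>1\<close>; by convention
  \<open>edges 0 = {}\<close>. A pair \<open>(e, f)\<close> belongs to \<open>edge_ord\<close> iff \<open>e \<le> f\<close>.\<close>

record ('v, 'e) bratteli =
  verts :: "nat \<Rightarrow> 'v set"
  edges :: "nat \<Rightarrow> 'e set"
  range_of :: "'e \<Rightarrow> 'v"
  source_of :: "'e \<Rightarrow> 'v"
  edge_ord :: "('e \<times> 'e) set"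

definition all_verts :: "('v, 'e) bratteli \<Rightarrow> 'v set" where
  "all_verts B = (\<Union>n. verts B n)"

definition all_edges :: "('v, 'e) bratteli \<Rightarrow> 'e set" where
  "all_edges B = (\<Union>n. edges B n)"

definition ordered_bratteli :: "('v, 'e) bratteli \<Rightarrow> bool" where
  "ordered_bratteli B \<longleftrightarrow>
     disjoint_family (verts B) \<and> disjoint_family (edges B) \<and>
     (\<forall>n. finite (verts B n) \<and> verts B n \<noteq> {}) \<and>
     edges B 0 = {} \<and> (\<forall>n\<ge>1. finite (edges B n) \<and> edges B n \<noteq> {}) \<and>
     (\<exists>v0. verts B 0 = {v0}) \<and>
     (\<forall>n\<ge>1. range_of B ` edges B n = verts B n \<and> source_of B ` edges B n = verts B (n - 1)) \<and>
     (\<forall>v \<in> all_verts B. \<exists>e \<in> all_edges B. source_of B e = v) \<and>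
     (\<forall>v \<in> all_verts B - verts B 0. \<exists>e \<in> all_edges B. range_of B e = v) \<and>
     partial_order_on (all_edges B) (edge_ord B) \<and>
     (\<forall>e \<in> all_edges B. \<forall>f \<in> all_edges B.
        (e, f) \<in> edge_ord B \<or> (f, e) \<in> edge_ord B \<longleftrightarrow> range_of B e = range_of B f)"

text \<open>The edge \<open>(n, m, k, j')\<close> records that the \<open>k\<close>-th tower of \<open>P n\<close> runs through the \<open>m\<close>-th
  tower of \<open>P (n - 1)\<close> starting just above height \<open>j'\<close>.\<close>

definition kr_edges :: "(nat \<Rightarrow> 'a kr) \<Rightarrow> nat \<Rightarrow> (nat \<times> nat \<times> nat \<times> nat) set" where
  "kr_edges P n = (if n = 0 then {} else
     {(n, m, k, j') | m k j'.
        m \<in> {1..towers (P (n - 1))} \<and> k \<in> {1..towers (P n)} \<and>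
        j' + height (P (n - 1)) m \<le> height (P n) k \<and>
        (\<forall>j \<in> {1..height (P (n - 1)) m}. cell (P n) k (j + j') \<subseteq> cell (P (n - 1)) m j)})"

definition kr_bratteli ::
    "(nat \<Rightarrow> 'a kr) \<Rightarrow> (nat \<times> nat, nat \<times> nat \<times> nat \<times> nat) bratteli" where
  "kr_bratteli P =
    \<lparr> verts = (\<lambda>n. {n} \<times> {1..towers (P n)}),
      edges = kr_edges P,
      range_of = (\<lambda>(n, m, k, j'). (n, k)),
      source_of = (\<lambda>(n, m, k, j'). (n - 1, m)),
      edge_ord = {((n, m1, k, j1), (n, m2, k, j2)) | n m1 m2 k j1 j2.
        (n, m1, k, j1) \<in> kr_edges P n \<and> (n, m2, k, j2) \<in> kr_edges P n \<and> j1 \<le> j2} \<rparr>"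


section \<open>Isomorphism, contraction and equivalence\<close>

text \<open>A path \<open>e\<^sub>k\<^sub>+\<^sub>1 \<dots> e\<^sub>l\<close> is a list whose \<open>i\<close>-th entry is the edge of level \<open>k + 1 + i\<close>.\<close>

definition paths :: "('v, 'e) bratteli \<Rightarrow> nat \<Rightarrow> nat \<Rightarrow> 'e list set" where
  "paths B k l = {es. length es = l - k \<and>
     (\<forall>i < length es. es ! i \<in> edges B (k + 1 + i)) \<and>
     (\<forall>i. i + 1 < length es \<longrightarrow> range_of B (es ! i) = source_of B (es ! (i + 1)))}"

definition path_less :: "('v, 'e) bratteli \<Rightarrow> 'e list \<Rightarrow> 'e list \<Rightarrow> bool" where
  "path_less B es fs \<longleftrightarrow>
     (\<exists>i < length es. (\<forall>j. i < j \<and> j < length es \<longrightarrow> es ! j = fs ! j) \<and>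
        (es ! i, fs ! i) \<in> edge_ord B \<and> es ! i \<noteq> fs ! i)"

definition contraction :: "(nat \<Rightarrow> nat) \<Rightarrow> ('v, 'e) bratteli \<Rightarrow> ('v, 'e list) bratteli" where
  "contraction m B =
    \<lparr> verts = (\<lambda>n. verts B (m n)),
      edges = (\<lambda>n. if n = 0 then {} else paths B (m (n - 1)) (m n)),
      range_of = (\<lambda>es. range_of B (last es)),
      source_of = (\<lambda>es. source_of B (hd es)),
      edge_ord = {(es, fs). \<exists>n\<ge>1.
        es \<in> paths B (m (n - 1)) (m n) \<and> fs \<in> paths B (m (n - 1)) (m n) \<and>
        range_of B (last es) = range_of B (last fs) \<and> (es = fs \<or> path_less B es fs)} \<rparr>"

definition bratteli_iso :: "('v, 'e) bratteli \<Rightarrow> ('w, 'f) bratteli \<Rightarrow> bool" where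
  "bratteli_iso B C \<longleftrightarrow>
     (\<exists>\<phi> \<psi>. bij_betw \<phi> (all_verts B) (all_verts C) \<and> bij_betw \<psi> (all_edges B) (all_edges C) \<and>
        (\<forall>n. \<phi> ` verts B n = verts C n) \<and> (\<forall>n. \<psi> ` edges B n = edges C n) \<and>
        (\<forall>e \<in> all_edges B. range_of C (\<psi> e) = \<phi> (range_of B e) \<and>
                            source_of C (\<psi> e) = \<phi> (source_of B e)) \<and>
        (\<forall>e \<in> all_edges B. \<forall>f \<in> all_edges B.
           (e, f) \<in> edge_ord B \<longleftrightarrow> (\<psi> e, \<psi> f) \<in> edge_ord C))"

text \<open>A contraction has a different edge type (lists of edges), whereas the generated equivalence
  relation has to live on a single type. The generating step is therefore taken to be ``isomorphic
  to the diagram or to one of its contractions''. When \<open>'v\<close> and \<open>'e\<close> are infinite types (as they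
  are for \<^const>\<open>kr_bratteli\<close>), every ordered Bratteli diagram, having only countably many
  vertices and edges, is isomorphic to one over these types, so that restricting the
  intermediate diagrams to them changes nothing.\<close>

definition bratteli_step :: "('v, 'e) bratteli \<Rightarrow> ('v, 'e) bratteli \<Rightarrow> bool" where
  "bratteli_step B C \<longleftrightarrow> ordered_bratteli B \<and> ordered_bratteli C \<and>
     (bratteli_iso B C \<or>
      (\<exists>m. strict_mono m \<and> m 0 = 0 \<and> bratteli_iso (contraction m B) C))"

definition bratteli_equiv :: "('v, 'e) bratteli \<Rightarrow> ('v, 'e) bratteli \<Rightarrow> bool" where
  "bratteli_equiv B C \<longleftrightarrow>
     ordered_bratteli B \<and> ordered_bratteli C \<and> equivclp bratteli_step B C"

end

theory Submission
  imports Defs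
begin

text \<open>If a Kakutani-Rokhlin partition \<open>Q\<close> refines \<open>P\<close> and its base lies in the base of \<open>P\<close>, then every
  tower of \<open>Q\<close> is a stack of complete towers of \<open>P\<close>; the edges record these visits. The visits
  compose along \<open>P, Q, R\<close>, uniquely and compatibly with the order, so that contracting the diagram of
  such a chain of partitions gives the diagram of the corresponding subsequence. By compactness two
  admissible sequences have subsequences that interleave to a single chain; the diagram of this
  chain contracts to the diagrams of both subsequences.\<close>

section \<open>Towers of a finer Kakutani-Rokhlin partition\<close>

text \<open>Neither sequence need be a contraction of the other, so the equivalence has to pass
  through a third diagram, built from a sequence that mixes partitions of both. The diagram
  arguments are therefore stated for chains, a notion that such a mixture satisfies directly;
  compactness is used only to build it. A contraction must keep level 0, whereas one of the two
  interleaved subsequences does not contain the initial term of the chain. This is repaired by the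
  fact that both sequences start with the trivial partition. Of \<open>h\<close> the locale records
  the injectivity by which an inclusion of cells is pulled back one level.\<close>

locale partial_injection =
  fixes X :: "'a topology" and U V :: "'a set" and h :: "'a \<Rightarrow> 'a"
  assumes inj_h: "inj_on h U"
begin

abbreviation kr :: "'a kr \<Rightarrow> bool" where
  "kr \<equiv> kr_partition X U V h"

lemma kr_index_iff: "(k, j) \<in> kr_index P \<longleftrightarrow> k \<in> {1..towers P} \<and> j \<in> {1..height P k}"
  by (simp add: kr_index_def)

lemma cell_unique:
  assumes "kr P" "(k, j) \<in> kr_index P" "(k', j') \<in> kr_index P" "x \<in> cell P k j" "x \<in> cell P k' j'"
  shows "k = k' \<and> j = j'"
proof -
  have "disjoint (kr_cells P)" and inj: "inj_on (\<lambda>(k, j). cell P k j) (kr_index P)"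
    using assms(1) by (auto simp: kr_partition_def partition_on_def)
  moreover have "cell P k j \<in> kr_cells P" "cell P k' j' \<in> kr_cells P"
    using assms(2,3) by (force simp: kr_cells_def)+
  ultimately have "cell P k j = cell P k' j'"
    using assms(4,5) by (auto simp: disjoint_def)
  then show ?thesis
    using inj_onD[OF inj, of "(k, j)" "(k', j')"] assms(2,3) by simp
qed

lemma cell_nonempty:
  assumes "kr P" "(k, j) \<in> kr_index P"
  shows "cell P k j \<noteq> {}"
proof -
  have "cell P k j \<in> kr_cells P"
    using assms(2) by (force simp: kr_cells_def)
  then show ?thesis
    using assms(1) by (auto simp: kr_partition_def partition_on_def)
qed

lemma cell_index_unique:
  assumes "kr P" "(k, j) \<in> kr_index P" "(k', j') \<in> kr_index P"
    "C \<subseteq> cell P k j" "C \<subseteq> cell P k' j'" "C \<noteq> {}"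
  shows "k = k' \<and> j = j'"
  using cell_unique[OF assms(1-3)] assms(4-6) by blast

lemma cell_subset_topspace:
  assumes "kr P" "(k, j) \<in> kr_index P"
  shows "cell P k j \<subseteq> topspace X"
  using assms by (force simp: kr_partition_def partition_on_def kr_cells_def)

lemma height_pos: "kr P \<Longrightarrow> k \<in> {1..towers P} \<Longrightarrow> 1 \<le> height P k"
  by (auto simp: kr_partition_def Suc_le_eq)

lemma bottom_index: "kr P \<Longrightarrow> k \<in> {1..towers P} \<Longrightarrow> (k, 1) \<in> kr_index P"
  using height_pos by (simp add: kr_index_iff)

text \<open>Since \<open>h\<close> is a total HOL function, the image equation alone does not place
  the cell in the domain \<open>U\<close>. That inclusion holds because a point outside
  \<open>U\<close> lies in a top cell, and top cells are disjoint from the lower ones.\<close>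

lemma cell_step:
  assumes "kr P" "(k, j) \<in> kr_index P" "j < height P k"
  shows "h ` cell P k j = cell P k (Suc j)" "cell P k j \<subseteq> U"
proof -
  show "h ` cell P k j = cell P k (Suc j)"
    using assms by (auto simp: kr_partition_def kr_index_iff)
  show "cell P k j \<subseteq> U"
  proof (rule ccontr)
    assume "\<not> cell P k j \<subseteq> U"
    then obtain x where x: "x \<in> cell P k j" "x \<notin> U" by blast
    then have "x \<in> kr_top P"
      using assms(1) cell_subset_topspace[OF assms(1,2)] by (auto simp: kr_partition_def)
    then obtain k' where k': "k' \<in> {1..towers P}" "x \<in> cell P k' (height P k')"
      by (auto simp: kr_top_def)
    then have "(k', height P k') \<in> kr_index P"
      using height_pos[OF assms(1)] by (simp add: kr_index_iff)
    from cell_unique[OF assms(1,2) this x(1) k'(2)] assms(3) show False by simp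
  qed
qed

lemma top_step:
  assumes "kr P" "k \<in> {1..towers P}" "x \<in> cell P k (height P k)" "x \<in> U"
  shows "h x \<in> kr_base P"
proof -
  have "(\<Union>k \<in> {1..towers P}. h ` (cell P k (height P k) - (topspace X - U))) \<subseteq> kr_base P"
    using assms(1) unfolding kr_partition_def by blast
  then show ?thesis using assms(2-4) by blast
qed

lemma base_cell:
  assumes "kr P" "(k, j) \<in> kr_index P" "x \<in> cell P k j" "x \<in> kr_base P"
  shows "j = 1"
proof -
  obtain k' where "k' \<in> {1..towers P}" "x \<in> cell P k' 1"
    using assms(4) by (auto simp: kr_base_def)
  then show ?thesis
    using cell_unique[OF assms(1,2) bottom_index[OF assms(1)] assms(3)] by blast
qed

text \<open>Refinement alone would allow a tower of \<open>Q\<close> to begin or end in the middle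
  of a tower of \<open>P\<close>, for instance after cutting a tower of \<open>P\<close> into two.
  The inclusion of the bases excludes this.\<close>

definition kr_finer :: "'a kr \<Rightarrow> 'a kr \<Rightarrow> bool" where
  "kr_finer P Q \<longleftrightarrow> kr P \<and> kr Q \<and> refines (topspace X) (kr_cells Q) (kr_cells P) \<and>
     kr_base Q \<subseteq> kr_base P"

lemma kr_finer_trans: "kr_finer P Q \<Longrightarrow> kr_finer Q R \<Longrightarrow> kr_finer P R"
  unfolding kr_finer_def using refines_trans by blast

lemma finer_cell:
  assumes "kr_finer P Q" "(k, i) \<in> kr_index Q"
  obtains m j where "(m, j) \<in> kr_index P" "cell Q k i \<subseteq> cell P m j"
proof -
  have "cell Q k i \<in> kr_cells Q"
    using assms(2) by (force simp: kr_cells_def)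
  then obtain C where "C \<in> kr_cells P" "cell Q k i \<subseteq> C"
    using assms(1) by (auto simp: kr_finer_def refines_def)
  then show ?thesis using that by (auto simp: kr_cells_def)
qed

lemma finer_cell_of_point:
  assumes "kr_finer P Q" "(k, i) \<in> kr_index Q" "(m, j) \<in> kr_index P"
    "x \<in> cell Q k i" "x \<in> cell P m j"
  shows "cell Q k i \<subseteq> cell P m j"
proof -
  obtain m' j' where "(m', j') \<in> kr_index P" "cell Q k i \<subseteq> cell P m' j'"
    using finer_cell[OF assms(1,2)] .
  then show ?thesis
    using cell_unique[of P m j m' j' x] assms by (auto simp: kr_finer_def)
qed

text \<open>A tower of \<open>Q\<close> cannot end below the top of a tower of \<open>P\<close>:
  \<open>h\<close> would carry its top cell into the base of \<open>Q\<close>, hence into the base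
  of \<open>P\<close>, but also into level \<open>Suc j\<close> with \<open>j \<ge> 1\<close>, which
  is not a bottom level.\<close>

lemma climb:
  assumes "kr_finer P Q" "(k, i) \<in> kr_index Q" "(m, j) \<in> kr_index P"
    "cell Q k i \<subseteq> cell P m j" "j < height P m"
  shows "i < height Q k" "cell Q k (Suc i) \<subseteq> cell P m (Suc j)"
proof -
  have P: "kr P" and Q: "kr Q" and base: "kr_base Q \<subseteq> kr_base P"
    using assms(1) by (auto simp: kr_finer_def)
  note stepP = cell_step[OF P assms(3,5)]
  show i: "i < height Q k"
  proof (rule ccontr)
    assume "\<not> i < height Q k"
    then have top: "i = height Q k" "k \<in> {1..towers Q}"
      using assms(2) by (auto simp: kr_index_iff)
    obtain x where x: "x \<in> cell Q k i"
      using cell_nonempty[OF Q assms(2)] by blast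
    then have "h x \<in> kr_base P"
      using top_step[OF Q top(2)] top(1) stepP(2) assms(4) base by blast
    moreover have "h x \<in> cell P m (Suc j)"
      using stepP(1) x assms(4) by blast
    moreover have "(m, Suc j) \<in> kr_index P"
      using assms(3,5) by (simp add: kr_index_iff)
    ultimately have "Suc j = 1"
      using base_cell[OF P] by blast
    then show False
      using assms(3) by (simp add: kr_index_iff)
  qed
  show "cell Q k (Suc i) \<subseteq> cell P m (Suc j)"
    using cell_step(1)[OF Q assms(2) i] stepP(1) assms(4) by blast
qed

text \<open>The mirror image of \<open>climb\<close>: the bottom of a tower of \<open>Q\<close> lies
  in the base of \<open>P\<close>, so it cannot sit at a level above 1. The inclusion is carried
  down one level by the injectivity of \<open>h\<close> on \<open>U\<close>.\<close>

lemma descend: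
  assumes "kr_finer P Q" "(k, Suc i) \<in> kr_index Q" "(m, Suc j) \<in> kr_index P"
    "cell Q k (Suc i) \<subseteq> cell P m (Suc j)" "1 \<le> j"
  shows "1 \<le> i" "cell Q k i \<subseteq> cell P m j"
proof -
  have P: "kr P" and Q: "kr Q" and base: "kr_base Q \<subseteq> kr_base P"
    using assms(1) by (auto simp: kr_finer_def)
  show i: "1 \<le> i"
  proof (rule ccontr)
    assume "\<not> 1 \<le> i"
    then have [simp]: "i = 0" by simp
    obtain x where x: "x \<in> cell Q k (Suc i)"
      using cell_nonempty[OF Q assms(2)] by blast
    have "x \<in> kr_base Q"
      using x assms(2) by (auto simp: kr_base_def kr_index_iff)
    then have "Suc j = 1"
      using base_cell[OF P assms(3)] x assms(4) base by blast
    then show False using assms(5) by simp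
  qed
  have "(k, i) \<in> kr_index Q" "i < height Q k" "(m, j) \<in> kr_index P" "j < height P m"
    using assms(2,3,5) i by (auto simp: kr_index_iff)
  note stepQ = cell_step[OF Q this(1,2)] and stepP = cell_step[OF P this(3,4)]
  show "cell Q k i \<subseteq> cell P m j"
  proof
    fix x assume x: "x \<in> cell Q k i"
    then have "h x \<in> h ` cell P m j"
      using stepQ(1) stepP(1) assms(4) by blast
    then obtain y where "y \<in> cell P m j" "h x = h y" by blast
    then show "x \<in> cell P m j"
      using inj_onD[OF inj_h] x stepQ(2) stepP(2) by blast
  qed
qed

end

section \<open>Visits of a finer tower to a coarser one\<close>

text \<open>These are the edges with their level stripped off. They make sense for any two
  partitions, not only consecutive ones, which is what contractions call for. The number
  \<open>i\<close> counts the levels of the tower of \<open>Q\<close> below the visit, so that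
  offsets add under composition.\<close>

definition visits :: "'a kr \<Rightarrow> 'a kr \<Rightarrow> (nat \<times> nat \<times> nat) set" where
  "visits P Q = {(m, k, i). m \<in> {1..towers P} \<and> k \<in> {1..towers Q} \<and>
     i + height P m \<le> height Q k \<and>
     (\<forall>j \<in> {1..height P m}. cell Q k (j + i) \<subseteq> cell P m j)}"

lemma kr_edges_Suc: "kr_edges P (Suc n) = Pair (Suc n) ` visits (P n) (P (Suc n))"
  by (auto simp: kr_edges_def visits_def)

lemma kr_edges_0 [simp]: "kr_edges P 0 = {}"
  by (simp add: kr_edges_def)

lemma kr_edges_iff: "(n, m, k, i) \<in> kr_edges P l \<longleftrightarrow>
    l = n \<and> n \<noteq> 0 \<and> (m, k, i) \<in> visits (P (n - 1)) (P n)"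
  by (cases l) (auto simp: kr_edges_Suc)

context partial_injection
begin

text \<open>A visit is determined by its bottom level alone.\<close>

lemma visits_iff:
  assumes "kr_finer P Q"
  shows "(m, k, i) \<in> visits P Q \<longleftrightarrow>
    (m, 1) \<in> kr_index P \<and> (k, Suc i) \<in> kr_index Q \<and> cell Q k (Suc i) \<subseteq> cell P m 1"
    (is "?L \<longleftrightarrow> ?R")
proof
  assume ?L
  moreover have "kr P" using assms by (simp add: kr_finer_def)
  ultimately show ?R
    using height_pos[of P m] by (force simp: visits_def kr_index_iff)
next
  assume R: ?R
  \<comment> \<open>Each climbing step also shows that the tower of \<open>Q\<close> has not ended
    yet; this gives the bound on the heights.\<close>
  have *: "Suc i + j \<le> height Q k \<and> cell Q k (Suc i + j) \<subseteq> cell P m (Suc j)" if "Suc j \<le> height P m" for j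
    using that
  proof (induction j)
    case 0
    then show ?case using R by (simp add: kr_index_iff)
  next
    case (Suc j)
    then have IH: "Suc i + j \<le> height Q k" "cell Q k (Suc i + j) \<subseteq> cell P m (Suc j)" by simp_all
    have "(k, Suc i + j) \<in> kr_index Q" "(m, Suc j) \<in> kr_index P"
      using R IH(1) Suc.prems by (auto simp: kr_index_iff)
    from climb[OF assms this IH(2)] Suc.prems show ?case by simp
  qed
  have **: "Suc i + (j - 1) \<le> height Q k" "cell Q k (Suc i + (j - 1)) \<subseteq> cell P m (Suc (j - 1))"
    if "j \<in> {1..height P m}" for j
    using *[of "j - 1"] that by auto
  have "1 \<le> height P m" using R by (simp add: kr_index_iff)
  with **(1)[of "height P m"] have "i + height P m \<le> height Q k" by simp
  moreover have "cell Q k (j + i) \<subseteq> cell P m j" if "j \<in> {1..height P m}" for j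
    using **(2)[OF that] that by (simp add: add.commute)
  ultimately show ?L
    using R by (auto simp: visits_def kr_index_iff)
qed

lemma visits_levels:
  assumes "(m, k, i) \<in> visits P Q" "j < height P m"
  shows "(m, Suc j) \<in> kr_index P" "(k, Suc (i + j)) \<in> kr_index Q"
    "cell Q k (Suc (i + j)) \<subseteq> cell P m (Suc j)"
proof -
  show "(m, Suc j) \<in> kr_index P" "(k, Suc (i + j)) \<in> kr_index Q"
    using assms by (auto simp: visits_def kr_index_iff)
  have "Suc j \<in> {1..height P m}" using assms(2) by simp
  then have "cell Q k (Suc j + i) \<subseteq> cell P m (Suc j)"
    using assms(1) unfolding visits_def by blast
  then show "cell Q k (Suc (i + j)) \<subseteq> cell P m (Suc j)"
    by (simp add: add.commute)
qed

text \<open>Descending \<open>j\<close> times from any level of a tower of \<open>P\<close> reaches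
  its bottom without leaving the tower of \<open>Q\<close>, so the subtraction \<open>l - j\<close>
  is not truncated.\<close>

lemma visits_at_level:
  assumes "kr_finer P Q" "(m, Suc j) \<in> kr_index P" "(k, Suc l) \<in> kr_index Q"
    "cell Q k (Suc l) \<subseteq> cell P m (Suc j)"
  shows "j \<le> l \<and> (m, k, l - j) \<in> visits P Q"
  using assms(2-4)
proof (induction j arbitrary: l)
  case 0
  then show ?case using visits_iff[OF assms(1)] by simp
next
  case (Suc j)
  from descend[OF assms(1) Suc.prems(2,1,3)] have "1 \<le> l" "cell Q k l \<subseteq> cell P m (Suc j)" by simp_all
  then obtain l' where l: "l = Suc l'" by (cases l) auto
  then show ?case
    using Suc.IH[of l'] Suc.prems \<open>cell Q k l \<subseteq> cell P m (Suc j)\<close> by (auto simp: kr_index_iff)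
qed

text \<open>If the visits overlapped, the cell at level \<open>Suc i'\<close> would lie both at the
  bottom of the tower \<open>m'\<close> and strictly above the bottom of the tower
  \<open>m\<close>.\<close>

lemma visits_disjoint:
  assumes "kr_finer P Q" "(m, k, i) \<in> visits P Q" "(m', k, i') \<in> visits P Q" "i < i'"
  shows "i + height P m \<le> i'"
proof (rule ccontr)
  assume "\<not> i + height P m \<le> i'"
  then have less: "i' - i < height P m" using assms(4) by simp
  have P: "kr P" and Q: "kr Q" using assms(1) by (auto simp: kr_finer_def)
  have v': "(m', 1) \<in> kr_index P" "(k, Suc i') \<in> kr_index Q" "cell Q k (Suc i') \<subseteq> cell P m' 1"
    using visits_iff[OF assms(1)] assms(3) by auto
  have v: "(m, Suc (i' - i)) \<in> kr_index P" "cell Q k (Suc i') \<subseteq> cell P m (Suc (i' - i))"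
    using visits_levels[OF assms(2) less] assms(4) by auto
  show False
    using cell_index_unique[OF P v(1) v'(1) v(2) v'(3) cell_nonempty[OF Q v'(2)]] assms(4) by simp
qed

text \<open>This makes the edge order antisymmetric: it compares offsets only, and edges with the
  same range and offset must coincide.\<close>

lemma visits_source_unique:
  assumes "kr_finer P Q" "(m, k, i) \<in> visits P Q" "(m', k, i) \<in> visits P Q"
  shows "m = m'"
proof -
  have P: "kr P" and Q: "kr Q" using assms(1) by (auto simp: kr_finer_def)
  show ?thesis
    using assms(2,3) cell_nonempty[OF Q] cell_index_unique[OF P]
    unfolding visits_iff[OF assms(1)] by blast
qed

text \<open>By \<open>visits_iff\<close> only the bottom of the tower \<open>m\<close> has to be
  located. It contains level \<open>Suc i\<close> of the tower \<open>q\<close>, which in turn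
  contains level \<open>Suc (i + j)\<close> of the tower \<open>r\<close>.\<close>

lemma visits_compose:
  assumes "kr_finer P Q" "kr_finer Q R" "(m, q, i) \<in> visits P Q" "(q, r, j) \<in> visits Q R"
  shows "(m, r, i + j) \<in> visits P R"
proof -
  have PR: "kr_finer P R" using kr_finer_trans assms(1,2) .
  have v: "(m, 1) \<in> kr_index P" "(q, Suc i) \<in> kr_index Q" "cell Q q (Suc i) \<subseteq> cell P m 1"
    using visits_iff[OF assms(1)] assms(3) by auto
  then have "i < height Q q" by (simp add: kr_index_iff)
  from visits_levels[OF assms(4) this] v show ?thesis
    unfolding visits_iff[OF PR] by (auto simp: add.commute)
qed

text \<open>The intermediate tower \<open>q\<close> is the one whose cell contains the bottom of the
  given visit. Descending from that cell to the bottom of \<open>q\<close> finds the visit of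
  \<open>r\<close> to \<open>q\<close>.\<close>

lemma visits_decompose:
  assumes "kr_finer P Q" "kr_finer Q R" "(m, r, l) \<in> visits P R"
  obtains q i j where "(m, q, i) \<in> visits P Q" "(q, r, j) \<in> visits Q R" "l = i + j"
proof -
  have PR: "kr_finer P R" using kr_finer_trans assms(1,2) .
  then have R: "kr R" by (simp add: kr_finer_def)
  have v: "(m, 1) \<in> kr_index P" "(r, Suc l) \<in> kr_index R" "cell R r (Suc l) \<subseteq> cell P m 1"
    using visits_iff[OF PR] assms(3) by auto
  obtain q i' where q: "(q, i') \<in> kr_index Q" "cell R r (Suc l) \<subseteq> cell Q q i'"
    using finer_cell[OF assms(2) v(2)] .
  then obtain i where i: "i' = Suc i" by (cases i') (auto simp: kr_index_iff)
  obtain x where "x \<in> cell R r (Suc l)" using cell_nonempty[OF R v(2)] by blast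
  then have "cell Q q i' \<subseteq> cell P m 1"
    using finer_cell_of_point[OF assms(1) q(1) v(1)] q(2) v(3) by blast
  then have 1: "(m, q, i) \<in> visits P Q"
    using visits_iff[OF assms(1)] v(1) q(1) i by simp
  have 2: "i \<le> l" "(q, r, l - i) \<in> visits Q R"
    using visits_at_level[OF assms(2) _ v(2)] q i by auto
  show ?thesis
    using that[OF 1 2(2)] 2(1) by simp
qed

text \<open>Comparing visits of the tower \<open>r\<close> that factor through \<open>Q\<close> is comparing lexicographically
  from the range end, because the visits to \<open>Q\<close> occupy disjoint intervals of levels.\<close>

lemma visits_compose_less_iff:
  assumes "kr_finer P Q" "kr_finer Q R"
    "(m, q, i) \<in> visits P Q" "(q, r, j) \<in> visits Q R"
    "(m', q', i') \<in> visits P Q" "(q', r, j') \<in> visits Q R"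
  shows "i + j < i' + j' \<longleftrightarrow> j < j' \<or> j = j' \<and> i < i'"
proof -
  have "i < height Q q" "i' < height Q q'"
    using assms(3,5) visits_iff[OF assms(1)] by (auto simp: kr_index_iff)
  moreover have "j < j' \<Longrightarrow> j + height Q q \<le> j'" "j' < j \<Longrightarrow> j' + height Q q' \<le> j"
    using visits_disjoint[OF assms(2)] assms(4,6) by blast+
  ultimately show ?thesis by linarith
qed

text \<open>The bottom of a tower of \<open>Q\<close> lies in the base of \<open>P\<close>, so a
  visit starts right there, with offset 0.\<close>

lemma visits_range_ex:
  assumes "kr_finer P Q" "k \<in> {1..towers Q}"
  shows "\<exists>m. (m, k, 0) \<in> visits P Q"
proof -
  have P: "kr P" and Q: "kr Q" and base: "kr_base Q \<subseteq> kr_base P"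
    using assms(1) by (auto simp: kr_finer_def)
  have k: "(k, 1) \<in> kr_index Q" using bottom_index[OF Q assms(2)] .
  then obtain x where x: "x \<in> cell Q k 1" using cell_nonempty[OF Q] by blast
  obtain m j where m: "(m, j) \<in> kr_index P" "cell Q k 1 \<subseteq> cell P m j"
    using finer_cell[OF assms(1) k] .
  have "x \<in> kr_base Q" using x assms(2) by (auto simp: kr_base_def)
  with base have "x \<in> kr_base P" by blast
  then have "j = 1" using base_cell[OF P m(1)] x m(2) by blast
  then show ?thesis using m k visits_iff[OF assms(1)] by auto
qed

text \<open>By refinement, a cell of \<open>Q\<close> that meets the bottom of a tower of
  \<open>P\<close> is contained in it, and this already determines a visit.\<close>

lemma visits_source_ex:
  assumes "kr_finer P Q" "m \<in> {1..towers P}"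
  shows "\<exists>k i. (m, k, i) \<in> visits P Q"
proof -
  have P: "kr P" and Q: "kr Q" using assms(1) by (auto simp: kr_finer_def)
  have m: "(m, 1) \<in> kr_index P" using bottom_index[OF P assms(2)] .
  then obtain x where x: "x \<in> cell P m 1" using cell_nonempty[OF P] by blast
  then have "x \<in> \<Union> (kr_cells Q)"
    using cell_subset_topspace[OF P m] Q by (auto simp: kr_partition_def partition_on_def)
  then obtain k i' where k: "(k, i') \<in> kr_index Q" "x \<in> cell Q k i'"
    by (auto simp: kr_cells_def)
  then obtain i where "i' = Suc i" by (cases i') (auto simp: kr_index_iff)
  then show ?thesis
    using visits_iff[OF assms(1)] finer_cell_of_point[OF assms(1) k(1) m k(2) x] m k(1) by auto
qed

lemma finite_visits: "finite (visits P Q)"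
proof (rule finite_subset)
  show "visits P Q \<subseteq> {1..towers P} \<times> {1..towers Q} \<times> {..Max (height Q ` {1..towers Q})}"
  proof (clarsimp simp: visits_def)
    fix m k i
    assume k: "Suc 0 \<le> k" "k \<le> towers Q" and "i + height P m \<le> height Q k"
    then have "i \<le> height Q k" by simp
    also have "\<dots> \<le> Max (height Q ` {Suc 0..towers Q})" using k by (intro Max_ge) auto
    finally show "i \<le> Max (height Q ` {Suc 0..towers Q})" .
  qed
qed simp

section \<open>The diagram of a chain\<close>

text \<open>The part of admissibility that the diagram sees: a single root, and partitions that
  refine one another with nested bases. It passes to subsequences that start at 0.\<close>

definition kr_chain :: "(nat \<Rightarrow> 'a kr) \<Rightarrow> bool" where
  "kr_chain P \<longleftrightarrow> towers (P 0) = 1 \<and> (\<forall>n. kr_finer (P n) (P (Suc n)))"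

lemma kr_chain_finer:
  assumes "kr_chain P" "k < l"
  shows "kr_finer (P k) (P l)"
  using assms(2)
proof (induction rule: strict_inc_induct)
  case (base i)
  then show ?case using assms(1) by (simp add: kr_chain_def)
next
  case (step i)
  then show ?case using assms(1) kr_finer_trans by (auto simp: kr_chain_def)
qed

lemma kr_chain_subseq:
  assumes "kr_chain P" "strict_mono m" "m 0 = 0"
  shows "kr_chain (P \<circ> m)"
  using assms kr_chain_finer[OF assms(1)] by (auto simp: kr_chain_def strict_mono_Suc_iff)

lemma ordered_bratteli_kr_bratteli:
  assumes "kr_chain P"
  shows "ordered_bratteli (kr_bratteli P)"
proof -
  let ?B = "kr_bratteli P"
  have finer: "kr_finer (P n) (P (Suc n))" for n
    using assms by (simp add: kr_chain_def)
  have kr: "kr (P n)" for n using finer[of n] by (simp add: kr_finer_def)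
  have verts: "verts ?B n = {n} \<times> {1..towers (P n)}" for n
    by (simp add: kr_bratteli_def)
  have edges: "edges ?B = kr_edges P" by (simp add: kr_bratteli_def)
  have range: "range_of ?B (n, m, k, i) = (n, k)" and source: "source_of ?B (n, m, k, i) = (n - 1, m)"
    for n m k i by (simp_all add: kr_bratteli_def)
  have all: "(n, m, k, i) \<in> all_edges ?B \<longleftrightarrow> n \<noteq> 0 \<and> (m, k, i) \<in> visits (P (n - 1)) (P n)" for n m k i
    by (auto simp: all_edges_def edges kr_edges_iff)
  have ord: "((n, m, k, i), (n', m', k', i')) \<in> edge_ord ?B \<longleftrightarrow>
      (n, m, k, i) \<in> all_edges ?B \<and> (n', m', k', i') \<in> all_edges ?B \<and> n = n' \<and> k = k' \<and> i \<le> i'"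
    for n m k i n' m' k' i'
    unfolding all by (auto simp: kr_bratteli_def kr_edges_iff)
  have src_ex: "\<exists>e \<in> kr_edges P (Suc n). source_of ?B e = v" if v: "v \<in> verts ?B n" for n v
  proof -
    obtain m where m: "v = (n, m)" "m \<in> {1..towers (P n)}" using v by (auto simp: verts)
    then obtain k i where "(m, k, i) \<in> visits (P n) (P (Suc n))"
      using visits_source_ex[OF finer] by blast
    then show ?thesis by (intro bexI[of _ "(Suc n, m, k, i)"]) (auto simp: source m kr_edges_iff)
  qed
  have rng_ex: "\<exists>e \<in> kr_edges P (Suc n). range_of ?B e = v" if v: "v \<in> verts ?B (Suc n)" for n v
  proof -
    obtain k where k: "v = (Suc n, k)" "k \<in> {1..towers (P (Suc n))}" using v by (auto simp: verts)
    then obtain m where "(m, k, 0) \<in> visits (P n) (P (Suc n))"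
      using visits_range_ex[OF finer] by blast
    then show ?thesis by (intro bexI[of _ "(Suc n, m, k, 0)"]) (auto simp: range k kr_edges_iff)
  qed
  have verts_ne: "verts ?B n \<noteq> {}" for n
    using kr[of n] by (auto simp: verts kr_partition_def)
  have fin: "finite (kr_edges P n)" for n
    by (cases n) (auto simp: kr_edges_Suc finite_visits)
  have rs: "range_of ?B ` kr_edges P (Suc n) = verts ?B (Suc n)"
    "source_of ?B ` kr_edges P (Suc n) = verts ?B n" for n
  proof -
    have "range_of ?B ` kr_edges P (Suc n) \<subseteq> verts ?B (Suc n)"
      "source_of ?B ` kr_edges P (Suc n) \<subseteq> verts ?B n"
      by (auto simp: verts kr_edges_iff range source visits_def)
    then show "range_of ?B ` kr_edges P (Suc n) = verts ?B (Suc n)"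
      "source_of ?B ` kr_edges P (Suc n) = verts ?B n"
      using rng_ex src_ex by blast+
  qed
  have "partial_order_on (all_edges ?B) (edge_ord ?B)"
    unfolding partial_order_on_def preorder_on_def
  proof (intro conjI)
    show "edge_ord ?B \<subseteq> all_edges ?B \<times> all_edges ?B"
      by (auto simp: ord)
    show "refl_on (all_edges ?B) (edge_ord ?B)"
      by (auto simp: refl_on_def ord)
    show "trans (edge_ord ?B)" by (auto simp: trans_def ord)
    show "antisym (edge_ord ?B)"
    proof (rule antisymI)
      fix e f assume ef: "(e, f) \<in> edge_ord ?B" "(f, e) \<in> edge_ord ?B"
      obtain n m k i where e: "e = (n, m, k, i)" by (cases e)
      obtain n' m' k' i' where f: "f = (n', m', k', i')" by (cases f)
      from ef have *: "n' = n" "k' = k" "i' = i" "n \<noteq> 0"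
        "(m, k, i) \<in> visits (P (n - 1)) (P n)" "(m', k, i) \<in> visits (P (n - 1)) (P n)"
        by (auto simp: e f ord all)
      then have "m = m'"
        using visits_source_unique[of "P (n - 1)" "P n"] finer[of "n - 1"] by auto
      with * show "e = f" by (simp add: e f)
    qed
  qed
  moreover have "(e, f) \<in> edge_ord ?B \<or> (f, e) \<in> edge_ord ?B \<longleftrightarrow> range_of ?B e = range_of ?B f"
    if "e \<in> all_edges ?B" "f \<in> all_edges ?B" for e f
    using that by (cases e; cases f) (auto simp: ord range)
  moreover have "disjoint_family (verts ?B)" by (auto simp: disjoint_family_on_def verts)
  moreover have "disjoint_family (edges ?B)"
    by (auto simp: disjoint_family_on_def edges kr_edges_iff)
  moreover have "finite (verts ?B n)" for n by (simp add: verts)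
  moreover have "\<exists>v0. verts ?B 0 = {v0}" using assms by (simp add: verts kr_chain_def)
  moreover have "kr_edges P n \<noteq> {}" "range_of ?B ` kr_edges P n = verts ?B n"
    "source_of ?B ` kr_edges P n = verts ?B (n - 1)" if n1: "n \<ge> 1" for n
  proof -
    obtain n' where n: "n = Suc n'" using n1 by (cases n) auto
    show "range_of ?B ` kr_edges P n = verts ?B n"
      "source_of ?B ` kr_edges P n = verts ?B (n - 1)"
      using rs[of n'] n by simp_all
    then show "kr_edges P n \<noteq> {}" using verts_ne[of n] by force
  qed
  moreover have "\<exists>e \<in> all_edges ?B. source_of ?B e = v" if "v \<in> all_verts ?B" for v
    using that src_ex unfolding all_verts_def all_edges_def edges by blast
  moreover have "\<exists>e \<in> all_edges ?B. range_of ?B e = v" if v: "v \<in> all_verts ?B - verts ?B 0" for v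
  proof -
    obtain n where "v \<in> verts ?B n" "n \<noteq> 0" using v by (auto simp: all_verts_def)
    then obtain n' where "v \<in> verts ?B (Suc n')" by (cases n) auto
    then show ?thesis using rng_ex unfolding all_edges_def edges by blast
  qed
  ultimately show ?thesis
    unfolding ordered_bratteli_def edges using fin verts_ne by simp
qed

end

section \<open>Paths and their composite visits\<close>

text \<open>The offset of each edge is measured inside the tower at its range, so the sum of the
  offsets along a path is the offset of the source tower inside the last one.\<close>

definition path_visit :: "(nat \<times> nat \<times> nat \<times> nat) list \<Rightarrow> nat \<times> nat \<times> nat" where
  "path_visit es = (fst (snd (hd es)), fst (snd (snd (last es))), \<Sum>e\<leftarrow>es. snd (snd (snd e)))"

lemma paths_refl [simp]: "paths B k k = {[]}"
  by (auto simp: paths_def)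

text \<open>Paths are extended at the range end because their order is read from there. For
  \<open>k = l\<close> the prefix is empty and there is nothing to link.\<close>

lemma paths_Suc:
  assumes "k \<le> l"
  shows "es \<in> paths B k (Suc l) \<longleftrightarrow> (\<exists>fs e. es = fs @ [e] \<and> fs \<in> paths B k l \<and>
    e \<in> edges B (Suc l) \<and> (fs \<noteq> [] \<longrightarrow> range_of B (last fs) = source_of B e))" (is "?L \<longleftrightarrow> ?R")
proof
  assume L: ?L
  then have len: "length es = Suc (l - k)" using assms by (auto simp: paths_def)
  then obtain fs e where es: "es = fs @ [e]" by (cases es rule: rev_cases) auto
  have len': "length fs = l - k" using len es by simp
  have edge: "es ! i \<in> edges B (k + 1 + i)" if "i < Suc (length fs)" for i
    using L that es by (auto simp: paths_def)
  have link: "range_of B (es ! i) = source_of B (es ! (i + 1))" if "i < length fs" for i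
    using L that es by (auto simp: paths_def)
  have "fs ! i \<in> edges B (k + 1 + i)" if "i < length fs" for i
    using edge[of i] that es by (simp add: nth_append)
  moreover have "range_of B (fs ! i) = source_of B (fs ! (i + 1))" if "i + 1 < length fs" for i
    using link[of i] that es by (simp add: nth_append)
  moreover have "e \<in> edges B (Suc l)"
    using edge[of "length fs"] assms by (simp add: es len' del: append_assoc) (simp flip: len')
  moreover have "range_of B (last fs) = source_of B e" if "fs \<noteq> []"
    using link[of "length fs - 1"] that es by (simp add: nth_append last_conv_nth)
  ultimately show ?R using es len' by (auto simp: paths_def)
next
  assume ?R
  then obtain fs e where es: "es = fs @ [e]" "fs \<in> paths B k l" "e \<in> edges B (Suc l)"
    "fs \<noteq> [] \<Longrightarrow> range_of B (last fs) = source_of B e" by blast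
  then have len: "length fs = l - k" by (simp add: paths_def)
  have "es ! i \<in> edges B (k + 1 + i)" if "i < length es" for i
  proof (cases "i < length fs")
    case True
    then show ?thesis using es by (auto simp: nth_append paths_def)
  next
    case False
    then have "i = l - k" using that es(1) len by simp
    then show ?thesis using es(1,3) len assms by (simp add: nth_append)
  qed
  moreover have "range_of B (es ! i) = source_of B (es ! (i + 1))" if "i + 1 < length es" for i
  proof (cases "i + 1 < length fs")
    case True
    then show ?thesis using es(1,2) by (auto simp: nth_append paths_def)
  next
    case False
    then have "i = length fs - 1" "fs \<noteq> []" using that es(1) by auto
    then show ?thesis using es(1,4) by (auto simp: nth_append last_conv_nth)
  qed
  moreover have "length es = Suc l - k" using es(1) len assms by simp
  ultimately show ?L by (auto simp: paths_def)
qed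

text \<open>The index in \<open>path_less\<close> is the last place of disagreement, which is either
  the appended edge or a place in the prefixes.\<close>

lemma path_less_snoc:
  assumes "length es = length fs"
  shows "path_less B (es @ [e]) (fs @ [f]) \<longleftrightarrow>
    (e, f) \<in> edge_ord B \<and> e \<noteq> f \<or> e = f \<and> path_less B es fs" (is "?L \<longleftrightarrow> ?R")
proof
  assume ?L
  then obtain i where i: "i < Suc (length es)"
    "\<And>j. i < j \<Longrightarrow> j < Suc (length es) \<Longrightarrow> (es @ [e]) ! j = (fs @ [f]) ! j"
    "((es @ [e]) ! i, (fs @ [f]) ! i) \<in> edge_ord B" "(es @ [e]) ! i \<noteq> (fs @ [f]) ! i"
    by (auto simp: path_less_def)
  show ?R
  proof (cases "i < length es")
    case True
    then have "e = f" using i(2)[of "length es"] assms by (simp add: nth_append)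
    moreover have "es ! j = fs ! j" if "i < j" "j < length es" for j
      using i(2)[of j] that assms by (simp add: nth_append)
    ultimately show ?thesis
      using i(3,4) True assms by (auto simp: path_less_def nth_append)
  next
    case False
    then have "i = length es" using i(1) by simp
    then show ?thesis using i(3,4) assms by (simp add: nth_append)
  qed
next
  assume ?R
  then show ?L
  proof
    assume "(e, f) \<in> edge_ord B \<and> e \<noteq> f"
    then show ?thesis
      unfolding path_less_def using assms by (intro exI[of _ "length es"]) (auto simp: nth_append)
  next
    assume "e = f \<and> path_less B es fs"
    then obtain i where "e = f" "i < length es" "\<And>j. i < j \<Longrightarrow> j < length es \<Longrightarrow> es ! j = fs ! j"
      "(es ! i, fs ! i) \<in> edge_ord B" "es ! i \<noteq> fs ! i" by (auto simp: path_less_def)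
    then show ?thesis
      unfolding path_less_def using assms
      by (intro exI[of _ i]) (auto simp: nth_append less_Suc_eq)
  qed
qed

lemma kr_bratteli_sel:
  "verts (kr_bratteli P) n = {n} \<times> {1..towers (P n)}"
  "edges (kr_bratteli P) = kr_edges P"
  "range_of (kr_bratteli P) (n, m, k, i) = (n, k)"
  "source_of (kr_bratteli P) (n, m, k, i) = (n - 1, m)"
  "((n, m, k, i), (n', m', k', i')) \<in> edge_ord (kr_bratteli P) \<longleftrightarrow>
     n' = n \<and> k' = k \<and> i \<le> i' \<and> (n, m, k, i) \<in> kr_edges P n \<and> (n, m', k, i') \<in> kr_edges P n"
  by (auto simp: kr_bratteli_def)

lemma path_ends:
  assumes "es \<in> paths (kr_bratteli P) k l" "k < l"
  shows "es \<noteq> []" "hd es \<in> kr_edges P (Suc k)" "last es \<in> kr_edges P l"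
proof -
  have len: "length es = l - k" and e: "\<And>i. i < length es \<Longrightarrow> es ! i \<in> kr_edges P (k + 1 + i)"
    using assms(1) by (auto simp: paths_def kr_bratteli_sel)
  show ne: "es \<noteq> []" using len assms(2) by auto
  show "hd es \<in> kr_edges P (Suc k)" using e[of 0] ne by (simp add: hd_conv_nth)
  show "last es \<in> kr_edges P l"
    using e[of "length es - 1"] ne len assms(2) by (simp add: last_conv_nth)
qed

lemma path_ends_levels:
  assumes "es \<in> paths (kr_bratteli P) k l" "k < l" "path_visit es = (m, r, i)"
  shows "fst (last es) = l" "range_of (kr_bratteli P) (last es) = (l, r)"
    "source_of (kr_bratteli P) (hd es) = (k, m)"
proof -
  obtain n\<^sub>1 m\<^sub>1 k\<^sub>1 i\<^sub>1 where hd: "hd es = (n\<^sub>1, m\<^sub>1, k\<^sub>1, i\<^sub>1)" by (cases "hd es")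
  obtain n\<^sub>2 m\<^sub>2 k\<^sub>2 i\<^sub>2 where last: "last es = (n\<^sub>2, m\<^sub>2, k\<^sub>2, i\<^sub>2)" by (cases "last es")
  show "fst (last es) = l" "range_of (kr_bratteli P) (last es) = (l, r)"
    "source_of (kr_bratteli P) (hd es) = (k, m)"
    using path_ends[OF assms(1,2)] assms(3) unfolding hd last
    by (auto simp: kr_edges_iff kr_bratteli_sel path_visit_def hd last)
qed

lemma path_snocI:
  assumes "k < l" "fs \<in> paths (kr_bratteli P) k l" "path_visit fs = (m, q, i)"
    "(q, r, j) \<in> visits (P l) (P (Suc l))"
  shows "fs @ [(Suc l, q, r, j)] \<in> paths (kr_bratteli P) k (Suc l) \<and>
    path_visit (fs @ [(Suc l, q, r, j)]) = (m, r, i + j)"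
proof -
  have "fs @ [(Suc l, q, r, j)] \<in> paths (kr_bratteli P) k (Suc l)"
    using assms path_ends_levels(2)[OF assms(2,1,3)]
    by (subst paths_Suc) (auto simp: kr_bratteli_sel kr_edges_iff)
  then show ?thesis
    using assms(3) path_ends(1)[OF assms(2,1)] by (auto simp: path_visit_def)
qed

lemma path_snocE:
  assumes "k < l" "es \<in> paths (kr_bratteli P) k (Suc l)" "path_visit es = (m, r, s)"
  obtains fs q i j where "es = fs @ [(Suc l, q, r, j)]" "fs \<in> paths (kr_bratteli P) k l"
    "path_visit fs = (m, q, i)" "(q, r, j) \<in> visits (P l) (P (Suc l))" "s = i + j"
proof -
  obtain fs e where es: "es = fs @ [e]" "fs \<in> paths (kr_bratteli P) k l" "e \<in> kr_edges P (Suc l)"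
    "fs \<noteq> [] \<Longrightarrow> range_of (kr_bratteli P) (last fs) = source_of (kr_bratteli P) e"
    using assms(2) unfolding paths_Suc[OF less_imp_le[OF assms(1)]] kr_bratteli_sel(2) by blast
  obtain q r' j where e: "e = (Suc l, q, r', j)" "(q, r', j) \<in> visits (P l) (P (Suc l))"
    using es(3) by (auto simp: kr_edges_Suc)
  obtain m' q' i where fs: "path_visit fs = (m', q', i)" by (cases "path_visit fs")
  have "q' = q"
    using es(4) path_ends(1)[OF es(2) assms(1)] path_ends_levels(2)[OF es(2) assms(1) fs]
    by (simp add: e(1) kr_bratteli_sel)
  moreover from this have "m' = m" "r' = r" "s = i + j"
    using path_snocI[OF assms(1) es(2) _ e(2)] fs assms(3) by (simp_all add: es(1) e(1))
  ultimately show ?thesis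
    using that[of fs q j i] es(1,2) e fs by simp
qed

lemma single_path:
  "paths (kr_bratteli P) k (Suc k) = (\<lambda>v. [(Suc k, v)]) ` visits (P k) (P (Suc k))"
  by (auto simp: paths_Suc kr_bratteli_sel kr_edges_Suc)

lemma path_visit_single [simp]: "path_visit [(n, v)] = v"
  by (cases v) (simp add: path_visit_def)

section \<open>Contractions as diagrams of subsequences\<close>

context partial_injection
begin

text \<open>Induction on \<open>l\<close>: appending an edge composes visits, and
  \<open>visits_decompose\<close> gives surjectivity.\<close>

lemma path_visit_bij:
  assumes "kr_chain P" "k < l"
  shows "bij_betw path_visit (paths (kr_bratteli P) k l) (visits (P k) (P l))"
  using Suc_leI[OF assms(2)]
proof (induction l rule: dec_induct)
  case base
  show ?case
    unfolding single_path by (auto simp: bij_betw_def inj_on_def image_image)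
next
  case (step l)
  then have kl: "k < l" by simp
  have PQ: "kr_finer (P k) (P l)" and QR: "kr_finer (P l) (P (Suc l))"
    using kr_chain_finer[OF assms(1)] kl by auto
  have IH_inj: "inj_on path_visit (paths (kr_bratteli P) k l)"
    and IH_im: "path_visit ` paths (kr_bratteli P) k l = visits (P k) (P l)"
    using step.IH by (auto simp: bij_betw_def)
  show ?case
    unfolding bij_betw_def
  proof
    show "inj_on path_visit (paths (kr_bratteli P) k (Suc l))"
    proof
      fix es es' assume "es \<in> paths (kr_bratteli P) k (Suc l)"
        "es' \<in> paths (kr_bratteli P) k (Suc l)" and eq: "path_visit es = path_visit es'"
      obtain m r s where visit: "path_visit es = (m, r, s)" by (cases "path_visit es")
      obtain fs q i j where es: "es = fs @ [(Suc l, q, r, j)]" "fs \<in> paths (kr_bratteli P) k l"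
        "path_visit fs = (m, q, i)" "(q, r, j) \<in> visits (P l) (P (Suc l))" "s = i + j"
        using path_snocE[OF kl \<open>es \<in> _\<close> visit] .
      obtain fs' q' i' j' where es': "es' = fs' @ [(Suc l, q', r, j')]"
        "fs' \<in> paths (kr_bratteli P) k l" "path_visit fs' = (m, q', i')"
        "(q', r, j') \<in> visits (P l) (P (Suc l))" "s = i' + j'"
        using path_snocE[OF kl \<open>es' \<in> _\<close> visit[unfolded eq]] .
      have v: "(m, q, i) \<in> visits (P k) (P l)" "(m, q', i') \<in> visits (P k) (P l)"
        using IH_im es(2,3) es'(2,3) by force+
      \<comment> \<open>Different last offsets would order the two sums strictly, but both sums
        equal \<open>s\<close>. With \<open>j\<close> known, the middle tower and then the offset of
        the prefix are determined.\<close>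
      have "j = j'"
        using visits_compose_less_iff[OF PQ QR v(1) es(4) v(2) es'(4)]
          visits_compose_less_iff[OF PQ QR v(2) es'(4) v(1) es(4)] es(5) es'(5)
        by linarith
      moreover from this have "q = q'"
        using visits_source_unique[OF QR es(4)] es'(4) by simp
      ultimately show "es = es'"
        using inj_onD[OF IH_inj _ es(2) es'(2)] es(1,3,5) es'(1,3,5) by simp
    qed
    show "path_visit ` paths (kr_bratteli P) k (Suc l) = visits (P k) (P (Suc l))"
    proof
      show "path_visit ` paths (kr_bratteli P) k (Suc l) \<subseteq> visits (P k) (P (Suc l))"
      proof clarify
        fix es m r s
        assume path: "es \<in> paths (kr_bratteli P) k (Suc l)" and visit: "(m, r, s) = path_visit es"
        obtain fs q i j where fs: "es = fs @ [(Suc l, q, r, j)]" "fs \<in> paths (kr_bratteli P) k l"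
            "path_visit fs = (m, q, i)"
          and qrj: "(q, r, j) \<in> visits (P l) (P (Suc l))" and s: "s = i + j"
          using path_snocE[OF kl path visit[symmetric]] .
        have "(m, q, i) \<in> visits (P k) (P l)" using IH_im fs(2,3) by force
        then show "(m, r, s) \<in> visits (P k) (P (Suc l))"
          unfolding s using visits_compose[OF PQ QR] qrj by blast
      qed
      show "visits (P k) (P (Suc l)) \<subseteq> path_visit ` paths (kr_bratteli P) k (Suc l)"
      proof clarify
        fix m r s assume "(m, r, s) \<in> visits (P k) (P (Suc l))"
        then obtain q i j where "(m, q, i) \<in> visits (P k) (P l)"
          and qrj: "(q, r, j) \<in> visits (P l) (P (Suc l))" and s: "s = i + j"
          using visits_decompose[OF PQ QR] by blast
        then have "(m, q, i) \<in> path_visit ` paths (kr_bratteli P) k l" using IH_im by simp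
        then obtain fs where "fs \<in> paths (kr_bratteli P) k l" "path_visit fs = (m, q, i)" by force
        from path_snocI[OF kl this qrj] s
        show "(m, r, s) \<in> path_visit ` paths (kr_bratteli P) k (Suc l)" by (metis imageI)
      qed
    qed
  qed
qed

text \<open>For paths with a common range, the lexicographic order becomes a comparison of single
  numbers, as in the edge order of the diagram of a subsequence.\<close>

lemma path_less_iff:
  assumes "kr_chain P" "k < l"
    "es \<in> paths (kr_bratteli P) k l" "fs \<in> paths (kr_bratteli P) k l"
    "path_visit es = (m, r, i)" "path_visit fs = (m', r, i')"
  shows "path_less (kr_bratteli P) es fs \<longleftrightarrow> i < i'"
  using Suc_leI[OF assms(2)] assms(3-)
proof (induction l arbitrary: es fs m r i m' i' rule: dec_induct)
  case base
  have QR: "kr_finer (P k) (P (Suc k))"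
    using kr_chain_finer[OF assms(1)] by auto
  have e: "es = [(Suc k, m, r, i)]" "(m, r, i) \<in> visits (P k) (P (Suc k))"
    "fs = [(Suc k, m', r, i')]" "(m', r, i') \<in> visits (P k) (P (Suc k))"
    using base.prems by (auto simp: single_path)
  \<comment> \<open>\<open>path_less\<close> combines the reflexive edge order with inequality of
    edges. As the offset determines the source, together they mean strict inequality of
    offsets.\<close>
  moreover have "i = i' \<Longrightarrow> m = m'" using visits_source_unique[OF QR] e(2,4) by blast
  then have "i \<le> i' \<and> (m \<noteq> m' \<or> i \<noteq> i') \<longleftrightarrow> i < i'" by (cases "i = i'") auto
  ultimately show ?case
    by (simp add: path_less_def kr_bratteli_sel kr_edges_iff)
next
  case (step l)
  then have kl: "k < l" by simp
  have PQ: "kr_finer (P k) (P l)" and QR: "kr_finer (P l) (P (Suc l))"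
    using kr_chain_finer[OF assms(1)] kl by auto
  obtain es1 q j i1 where es: "es = es1 @ [(Suc l, q, r, j)]" "es1 \<in> paths (kr_bratteli P) k l"
    "path_visit es1 = (m, q, i1)" "(q, r, j) \<in> visits (P l) (P (Suc l))" "i = i1 + j"
    using path_snocE[OF kl step.prems(1,3)] .
  obtain fs1 q' j' i1' where fs: "fs = fs1 @ [(Suc l, q', r, j')]" "fs1 \<in> paths (kr_bratteli P) k l"
    "path_visit fs1 = (m', q', i1')" "(q', r, j') \<in> visits (P l) (P (Suc l))" "i' = i1' + j'"
    using path_snocE[OF kl step.prems(2,4)] .
  have v: "(m, q, i1) \<in> visits (P k) (P l)" "(m', q', i1') \<in> visits (P k) (P l)"
    using path_visit_bij[OF assms(1) kl] es(2,3) fs(2,3) bij_betwE by metis+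
  have len: "length es1 = length fs1" using es(2) fs(2) by (simp add: paths_def)
  have q: "j = j' \<Longrightarrow> q = q'" using visits_source_unique[OF QR] es(4) fs(4) by blast
  have "path_less (kr_bratteli P) es fs \<longleftrightarrow>
      j < j' \<or> j = j' \<and> path_less (kr_bratteli P) es1 fs1"
    unfolding es(1) fs(1) path_less_snoc[OF len] using es(4) fs(4) q
    by (auto simp: kr_bratteli_sel kr_edges_iff)
  also have "\<dots> \<longleftrightarrow> j < j' \<or> j = j' \<and> i1 < i1'"
    using step.IH[OF es(2) fs(2) es(3)] fs(3) q by auto
  also have "\<dots> \<longleftrightarrow> i < i'"
    using visits_compose_less_iff[OF PQ QR v(1) es(4) v(2) fs(4)] es(5) fs(5) by simp
  finally show ?case .
qed

lemma contraction_iso: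
  assumes "kr_chain P" "strict_mono m"
  shows "bratteli_iso (contraction m (kr_bratteli P)) (kr_bratteli (P \<circ> m))"
proof -
  let ?B = "kr_bratteli P"
  let ?C = "contraction m ?B"
  let ?D = "kr_bratteli (P \<circ> m)"
  \<comment> \<open>Vertices and edges of the contraction still carry their old level
    \<open>m n\<close>, and \<open>inv m\<close> renumbers it to \<open>n\<close>. A path takes the
    level of its last edge, since that edge ends at its range.\<close>
  define \<phi> where "\<phi> = (\<lambda>v :: nat \<times> nat. (inv m (fst v), snd v))"
  define \<psi> where "\<psi> = (\<lambda>es :: (nat \<times> nat \<times> nat \<times> nat) list. (inv m (fst (last es)), path_visit es))"
  have inv: "inv m (m n) = n" for n
    using inv_f_f[OF strict_mono_imp_inj_on[OF assms(2)]] .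
  have less: "m n < m (Suc n)" for n
    using assms(2) by (simp add: strict_mono_Suc_iff)
  have vC: "verts ?C n = {m n} \<times> {1..towers (P (m n))}"
    and eC: "edges ?C (Suc n) = paths ?B (m n) (m (Suc n))" "edges ?C 0 = {}" for n
    by (auto simp: contraction_def kr_bratteli_sel)
  have \<phi>_verts: "\<phi> ` verts ?C n = verts ?D n" for n
    by (force simp: vC kr_bratteli_sel \<phi>_def inv)
  have edgeC: "\<exists>n. e \<in> paths ?B (m n) (m (Suc n))" if e: "e \<in> all_edges ?C" for e
  proof -
    obtain n where "e \<in> edges ?C n" using e by (auto simp: all_edges_def)
    then show ?thesis using eC by (cases n) auto
  qed
  have lev: "fst (last e) = m (Suc n)" if "e \<in> paths ?B (m n) (m (Suc n))" for e n
    using path_ends(3)[OF that less] by (cases "last e") (auto simp: kr_edges_iff)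
  then have \<psi>: "\<psi> e = (Suc n, path_visit e)" if "e \<in> paths ?B (m n) (m (Suc n))" for e n
    using that by (simp add: \<psi>_def inv)
  have bij: "bij_betw path_visit (paths ?B (m n) (m (Suc n))) (visits (P (m n)) (P (m (Suc n))))" for n
    using path_visit_bij[OF assms(1) less] .
  have \<psi>_edges: "\<psi> ` edges ?C n = edges ?D n" for n
  proof (cases n)
    case 0
    then show ?thesis by (simp add: eC kr_bratteli_sel)
  next
    case (Suc n')
    have "\<psi> ` edges ?C n = Pair n ` path_visit ` paths ?B (m n') (m (Suc n'))"
      unfolding image_image using \<psi> Suc by (auto simp: eC)
    then show ?thesis
      using bij by (simp add: Suc kr_bratteli_sel kr_edges_Suc bij_betw_def)
  qed
  have "inj_on \<phi> (all_verts ?C)"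
    by (auto simp: inj_on_def \<phi>_def all_verts_def vC inv)
  moreover have "\<phi> ` all_verts ?C = all_verts ?D"
    unfolding all_verts_def image_UN \<phi>_verts ..
  moreover have "inj_on \<psi> (all_edges ?C)"
  proof
    fix e f assume "e \<in> all_edges ?C" "f \<in> all_edges ?C" and eq: "\<psi> e = \<psi> f"
    then obtain n n' where "e \<in> paths ?B (m n) (m (Suc n))" "f \<in> paths ?B (m n') (m (Suc n'))"
      using edgeC by blast
    moreover from this have "n' = n" "path_visit e = path_visit f" using eq \<psi> by auto
    ultimately show "e = f" using bij[of n] by (auto simp: bij_betw_def dest: inj_onD)
  qed
  moreover have "\<psi> ` all_edges ?C = all_edges ?D"
    unfolding all_edges_def image_UN \<psi>_edges ..
  moreover have "range_of ?D (\<psi> e) = \<phi> (range_of ?C e) \<and> source_of ?D (\<psi> e) = \<phi> (source_of ?C e)"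
    if e: "e \<in> all_edges ?C" for e
  proof -
    obtain n where e: "e \<in> paths ?B (m n) (m (Suc n))" using edgeC[OF e] by blast
    obtain a k i where v: "path_visit e = (a, k, i)" by (cases "path_visit e")
    show ?thesis
      using path_ends_levels[OF e less v] \<psi>[OF e] v
      by (simp add: contraction_def kr_bratteli_sel \<phi>_def inv)
  qed
  moreover have "(e, f) \<in> edge_ord ?C \<longleftrightarrow> (\<psi> e, \<psi> f) \<in> edge_ord ?D"
    if ef: "e \<in> all_edges ?C" "f \<in> all_edges ?C" for e f
  proof -
    obtain n where e: "e \<in> paths ?B (m n) (m (Suc n))" using edgeC[OF ef(1)] by blast
    obtain n' where f: "f \<in> paths ?B (m n') (m (Suc n'))" using edgeC[OF ef(2)] by blast
    obtain a k i where ve: "path_visit e = (a, k, i)" by (cases "path_visit e")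
    obtain a' k' i' where vf: "path_visit f = (a', k', i')" by (cases "path_visit f")
    have D: "(\<psi> e, \<psi> f) \<in> edge_ord ?D \<longleftrightarrow> n' = n \<and> k' = k \<and> i \<le> i'"
      using \<psi>[OF e] \<psi>[OF f] ve vf bij_betwE[OF bij] e f
      by (auto simp: kr_bratteli_sel kr_edges_iff) (metis ve vf)+
    \<comment> \<open>The order of the contraction quantifies over the level; the level of a path
      can be read off its last edge, which removes the quantifier.\<close>
    have unique: "l = n" if "e \<in> paths ?B (m l) (m (Suc l))" for l
      using lev[OF that] lev[OF e] inv by (metis Suc_inject)
    have "(e, f) \<in> edge_ord ?C \<longleftrightarrow> (\<exists>l. e \<in> paths ?B (m l) (m (Suc l)) \<and>
        f \<in> paths ?B (m l) (m (Suc l)) \<and> range_of ?B (last e) = range_of ?B (last f) \<and>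
        (e = f \<or> path_less ?B e f))"
      unfolding contraction_def by (auto simp: Suc_le_eq gr0_conv_Suc)
    also have "\<dots> \<longleftrightarrow> f \<in> paths ?B (m n) (m (Suc n)) \<and>
        range_of ?B (last e) = range_of ?B (last f) \<and> (e = f \<or> path_less ?B e f)"
      using e unique by blast
    also have "f \<in> paths ?B (m n) (m (Suc n)) \<longleftrightarrow> n' = n"
      using f lev[OF f] lev[of f n] inv by (metis Suc_inject)
    also have "n' = n \<and> range_of ?B (last e) = range_of ?B (last f) \<and> (e = f \<or> path_less ?B e f)
        \<longleftrightarrow> n' = n \<and> k' = k \<and> i \<le> i'"
    proof (cases "n' = n \<and> k' = k")
      case True
      then have f': "f \<in> paths ?B (m n) (m (Suc n))" and vf': "path_visit f = (a', k, i')"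
        using f vf by auto
      have "(a, k, i) \<in> visits (P (m n)) (P (m (Suc n)))" "(a', k, i') \<in> visits (P (m n)) (P (m (Suc n)))"
        using bij_betwE[OF bij] e f' ve vf' by metis+
      then have "i = i' \<Longrightarrow> a = a'"
        using visits_source_unique[OF kr_chain_finer[OF assms(1) less]] by blast
      then have "e = f \<longleftrightarrow> i = i'"
        using bij_betw_imp_inj_on[OF bij] e f' ve vf' by (metis inj_onD prod.inject)
      moreover have "path_less ?B e f \<longleftrightarrow> i < i'"
        using path_less_iff[OF assms(1) less e f' ve vf'] .
      moreover have "range_of ?B (last e) = range_of ?B (last f)"
        using path_ends_levels(2)[OF e less ve] path_ends_levels(2)[OF f' less vf'] by simp
      ultimately show ?thesis using True by auto
    next
      case False
      then show ?thesis
        using path_ends_levels(2)[OF e less ve] path_ends_levels(2)[OF f less vf] by auto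
    qed
    finally show ?thesis using D by simp
  qed
  ultimately show ?thesis
    unfolding bratteli_iso_def bij_betw_def using \<phi>_verts \<psi>_edges by blast
qed

lemma bratteli_step_subseq:
  assumes "kr_chain P" "strict_mono m" "m 0 = 0"
  shows "bratteli_step (kr_bratteli P) (kr_bratteli (P \<circ> m))"
  unfolding bratteli_step_def
  using assms contraction_iso ordered_bratteli_kr_bratteli kr_chain_subseq by blast

section \<open>Interleaving two admissible sequences\<close>

lemma admissible_baseD:
  assumes "admissible X U V h P"
  shows "decseq (\<lambda>n. kr_base (P n))" "openin X (kr_base (P n))" "closedin X (kr_base (P n))"
    "(\<Inter>n. kr_base (P n)) = topspace X - V"
  using assms unfolding admissible_def by blast+

lemma admissible_kr_chain: "admissible X U V h P \<Longrightarrow> kr_chain P"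
  by (auto simp: admissible_def kr_chain_def kr_finer_def decseq_Suc_iff)

lemma admissible_finer:
  "admissible X U V h P \<Longrightarrow> k < l \<Longrightarrow> kr_finer (P k) (P l)"
  using admissible_kr_chain kr_chain_finer by blast

lemma kr_cell_of_point:
  assumes "kr_finer P Q" "C \<in> kr_cells P" "D \<in> kr_cells Q" "x \<in> C" "x \<in> D"
  shows "D \<subseteq> C"
  using assms finer_cell_of_point by (force simp: kr_cells_def)

lemma kr_cell_ex:
  assumes "kr P" "x \<in> topspace X"
  shows "\<exists>C \<in> kr_cells P. x \<in> C"
  using assms by (auto simp: kr_partition_def partition_on_def)

text \<open>Generating the topology makes the cells a subbase only. They form a base because the
  partitions refine one another: two cells around \<open>x\<close> from different levels both
  contain the cell around \<open>x\<close> at any later level.\<close>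

lemma admissible_neighbourhood:
  assumes adm: "admissible X U V h Q" and "openin X W" "x \<in> W"
  shows "\<exists>l. \<exists>D \<in> kr_cells (Q l). x \<in> D \<and> D \<subseteq> W"
proof -
  have kr: "kr (Q n)" for n using adm by (simp add: admissible_def)
  have x: "x \<in> topspace X" using assms(2,3) openin_subset by blast
  have "openin (topology_generated_by (\<Union>n. kr_cells (Q n))) W"
    using adm assms(2) by (simp add: admissible_def)
  then have "generate_topology_on (\<Union>n. kr_cells (Q n)) W"
    by (simp add: openin_topology_generated_by_iff)
  then show ?thesis using assms(3)
  proof induction
    case (Int a b)
    then obtain l1 D1 l2 D2 where D: "D1 \<in> kr_cells (Q l1)" "x \<in> D1" "D1 \<subseteq> a"
      "D2 \<in> kr_cells (Q l2)" "x \<in> D2" "D2 \<subseteq> b" by auto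
    define l where "l = Suc (max l1 l2)"
    obtain D where "D \<in> kr_cells (Q l)" "x \<in> D" using kr_cell_ex[OF kr x] by blast
    moreover from this have "D \<subseteq> D1" "D \<subseteq> D2"
      using kr_cell_of_point[OF admissible_finer[OF adm, of l1 l]]
        kr_cell_of_point[OF admissible_finer[OF adm, of l2 l]] D by (auto simp: l_def)
    ultimately show ?case using D by blast
  next
    case (UN K)
    then obtain k where k: "k \<in> K" "x \<in> k" by blast
    then obtain l D where "D \<in> kr_cells (Q l)" "x \<in> D" "D \<subseteq> k" using UN.IH by blast
    with k(1) show ?case by blast
  qed auto
qed

lemma finite_kr_cells: "finite (kr_cells P)"
  by (simp add: kr_cells_def kr_index_def)

lemma compact_space_decseq_empty:
  fixes C :: "nat \<Rightarrow> 'b set"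
  assumes "compact_space Y" "\<And>n. closedin Y (C n)" "decseq C" "(\<Inter>n. C n) = {}"
  shows "\<exists>n. C n = {}"
  using compact_space_imp_nest[of Y C] assms by metis

text \<open>Compactness turns the pointwise statements (the bases shrink to \<open>X\<^sub>V\<close>, the cells around a point
  form a neighbourhood base) into uniform ones: the bad sets form a decreasing sequence of closed
  sets with empty intersection.\<close>

lemma admissible_eventually_finer:
  assumes "compact_space X" and P: "admissible X U V h P" and Q: "admissible X U V h Q"
  shows "\<exists>N. \<forall>l\<ge>N. kr_finer (P n) (Q l)"
proof -
  have krP: "kr (P n)" and krQ: "kr (Q l)" for l using P Q by (auto simp: admissible_def)
  have "\<exists>N. kr_base (Q N) - kr_base (P n) = {}"
  proof (rule compact_space_decseq_empty[OF assms(1)])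
    show "closedin X (kr_base (Q l) - kr_base (P n))" for l
      using admissible_baseD(2)[OF P] admissible_baseD(3)[OF Q] by (rule closedin_diff[rotated])
    show "decseq (\<lambda>l. kr_base (Q l) - kr_base (P n))"
      using admissible_baseD(1)[OF Q] by (auto simp: decseq_def)
    \<comment> \<open>The intersection is X_V, which lies in the base of every Kakutani-Rokhlin
      partition.\<close>
    have "(\<Inter>l. kr_base (Q l)) \<subseteq> kr_base (P n)"
      using admissible_baseD(4)[OF Q] krP by (simp add: kr_partition_def)
    then show "(\<Inter>l. kr_base (Q l) - kr_base (P n)) = {}" by blast
  qed
  then obtain N1 where N1: "kr_base (Q N1) \<subseteq> kr_base (P n)" by blast
  define bad where "bad = (\<lambda>l. {D \<in> kr_cells (Q l). \<not> (\<exists>C \<in> kr_cells (P n). D \<subseteq> C)})"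
  have "\<exists>N. \<Union> (bad N) = {}"
  proof (rule compact_space_decseq_empty[OF assms(1)])
    show "closedin X (\<Union> (bad l))" for l
    proof (rule closedin_Union)
      show "finite (bad l)" 
        using finite_subset[OF _ finite_kr_cells[of "Q l"]] by (auto simp: bad_def)
      show "closedin X D" if "D \<in> bad l" for D
        using krQ[of l] that by (simp add: bad_def kr_partition_def)
    qed
    show "decseq (\<lambda>l. \<Union> (bad l))"
    proof (rule decseq_SucI)
      fix l
      \<comment> \<open>A cell contained in a good cell is good, so every bad cell lies in a bad
        cell of the preceding level.\<close>
      have "kr_finer (Q l) (Q (Suc l))" using admissible_finer[OF Q] by simp
      then show "\<Union> (bad (Suc l)) \<subseteq> \<Union> (bad l)"
        unfolding bad_def kr_finer_def refines_def by fastforce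
    qed
    show "(\<Inter>l. \<Union> (bad l)) = {}"
    proof (rule ccontr)
      assume "(\<Inter>l. \<Union> (bad l)) \<noteq> {}"
      then obtain x where x: "\<And>l. x \<in> \<Union> (bad l)" by blast
      have "x \<in> topspace X"
        using x[of 0] krQ[of 0] by (auto simp: bad_def kr_partition_def partition_on_def)
      then obtain C where C: "C \<in> kr_cells (P n)" "x \<in> C" using kr_cell_ex[OF krP] by blast
      then have "openin X C" using krP by (auto simp: kr_partition_def)
      then obtain l D where D: "D \<in> kr_cells (Q l)" "x \<in> D" "D \<subseteq> C"
        using admissible_neighbourhood[OF Q] C(2) by blast
      obtain D' where D': "D' \<in> bad l" "x \<in> D'" using x[of l] by blast
      have "disjoint (kr_cells (Q l))" "D' \<in> kr_cells (Q l)"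
        using krQ[of l] D'(1) by (auto simp: bad_def kr_partition_def partition_on_def)
      then have "D' = D"
        using D(1,2) D'(2) by (auto dest: disjointD)
      then show False using D' D(3) C(1) by (auto simp: bad_def)
    qed
  qed
  then obtain N2 where N2: "\<Union> (bad N2) = {}" by blast
  \<comment> \<open>Members of a partition are nonempty, so an empty union leaves no bad
    cell.\<close>
  have "bad N2 = {}"
    using N2 krQ[of N2] by (auto simp: bad_def kr_partition_def partition_on_def)
  then have ref: "refines (topspace X) (kr_cells (Q N2)) (kr_cells (P n))"
    using krP krQ[of N2] by (auto simp: bad_def refines_def kr_partition_def)
  have "kr_finer (P n) (Q l)" if "Suc (max N1 N2) \<le> l" for l
    using that N1 ref admissible_finer[OF Q, of N1 l] admissible_finer[OF Q, of N2 l] krP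
    unfolding kr_finer_def using refines_trans by (meson Suc_le_lessD max_less_iff_conj order_trans)
  then show ?thesis by blast
qed

lemma admissible_interleave:
  assumes "compact_space X" and P: "admissible X U V h P" and Q: "admissible X U V h Q"
  obtains c where "strict_mono c" "c 0 = 0" "kr_chain (\<lambda>n. if even n then P (c n) else Q (c n))"
proof -
  have "\<exists>N. \<forall>l\<ge>N. kr_finer (P n) (Q l) \<and> kr_finer (Q n) (P l)" for n
    using admissible_eventually_finer[OF assms(1) P Q, of n]
      admissible_eventually_finer[OF assms(1) Q P, of n]
    by (metis nle_le order_trans)
  then obtain N where N: "\<And>n l. N n \<le> l \<Longrightarrow> kr_finer (P n) (Q l) \<and> kr_finer (Q n) (P l)"
    by metis
  \<comment> \<open>The summand \<open>N a\<close> makes the next index large enough for changing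
    from \<open>P\<close> to \<open>Q\<close> and from \<open>Q\<close> to \<open>P\<close>;
    \<open>Suc\<close> makes the indices strictly increasing.\<close>
  define c where "c = rec_nat 0 (\<lambda>_ a. Suc a + N a)"
  have c: "c 0 = 0" "c (Suc n) = Suc (c n) + N (c n)" for n by (simp_all add: c_def)
  have "strict_mono c" by (simp add: strict_mono_Suc_iff c)
  moreover have "kr_chain (\<lambda>n. if even n then P (c n) else Q (c n))"
    using P N by (auto simp: kr_chain_def c admissible_def)
  ultimately show ?thesis using that c(1) by blast
qed

text \<open>The initial partition carries no information: it is \<open>{X}\<close> for every admissible sequence.\<close>

lemma kr_bratteli_cong:
  assumes "admissible X U V h P" "admissible X U V h Q"
    "R 0 = P 0" "S 0 = Q 0" "\<And>n. R (Suc n) = S (Suc n)"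
  shows "kr_bratteli R = kr_bratteli S"
proof -
  have 0: "towers (R 0) = 1" "towers (S 0) = 1" "height (R 0) 1 = 1" "height (S 0) 1 = 1"
    "cell (R 0) 1 1 = cell (S 0) 1 1"
    using assms by (auto simp: admissible_def)
  have "kr_edges R n = kr_edges S n" for n
  proof (cases n)
    case (Suc n')
    have "visits (R n') (R (Suc n')) = visits (S n') (S (Suc n'))"
      using 0 assms(5) by (cases n') (auto simp: visits_def)
    then show ?thesis by (simp add: Suc kr_edges_Suc)
  qed simp
  moreover have "towers (R n) = towers (S n)" for n
    using 0 assms(5) by (cases n) auto
  ultimately show ?thesis by (simp add: kr_bratteli_def fun_eq_iff)
qed

lemma bratteli_equiv_admissible:
  assumes "compact_space X" and P: "admissible X U V h P" and Q: "admissible X U V h Q"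
  shows "bratteli_equiv (kr_bratteli P) (kr_bratteli Q)"
proof -
  obtain c where c: "strict_mono c" "c 0 = 0"
    and chain: "kr_chain (\<lambda>n. if even n then P (c n) else Q (c n))" (is "kr_chain ?R")
    using admissible_interleave[OF assms] .
  \<comment> \<open>The truncated subtraction gives \<open>b 0 = 0\<close> and then the odd numbers.
    Hence \<open>?R \<circ> b\<close> starts with \<open>P 0\<close> in place of \<open>Q 0\<close>,
    and \<open>kr_bratteli_cong\<close> exchanges the two.\<close>
  define a b :: "nat \<Rightarrow> nat" where "a = (\<lambda>n. 2 * n)" and "b = (\<lambda>n. 2 * n - 1)"
  have ab: "strict_mono a" "strict_mono b" "a 0 = 0" "b 0 = 0"
    by (auto simp: a_def b_def strict_mono_Suc_iff)
  have sub: "strict_mono (c \<circ> a)" "strict_mono (c \<circ> b)" "(c \<circ> a) 0 = 0" "(c \<circ> b) 0 = 0"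
    using c ab by (auto simp: strict_mono_o)
  have PR: "P \<circ> (c \<circ> a) = ?R \<circ> a" by (auto simp: a_def)
  have QR: "kr_bratteli (?R \<circ> b) = kr_bratteli (Q \<circ> (c \<circ> b))"
    using c(2) ab(4) by (intro kr_bratteli_cong[OF P Q]) (auto simp: b_def)
  have "bratteli_step (kr_bratteli P) (kr_bratteli (?R \<circ> a))"
    using bratteli_step_subseq[OF admissible_kr_chain[OF P] sub(1,3)] unfolding PR .
  moreover have "bratteli_step (kr_bratteli ?R) (kr_bratteli (?R \<circ> a))"
    using bratteli_step_subseq[OF chain ab(1,3)] .
  moreover have "bratteli_step (kr_bratteli ?R) (kr_bratteli (?R \<circ> b))"
    using bratteli_step_subseq[OF chain ab(2,4)] .
  moreover have "bratteli_step (kr_bratteli Q) (kr_bratteli (?R \<circ> b))"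
    using bratteli_step_subseq[OF admissible_kr_chain[OF Q] sub(2,4)] unfolding QR .
  \<comment> \<open>A zigzag: \<open>P\<close> and \<open>?R\<close> both step to
    \<open>?R \<circ> a\<close>, while \<open>?R\<close> and \<open>Q\<close> both step to
    \<open>?R \<circ> b\<close>.\<close>
  ultimately have "equivclp bratteli_step (kr_bratteli P) (kr_bratteli Q)"
    by (meson r_into_equivclp equivclp_sym equivclp_trans)
  then show ?thesis
    using P Q admissible_kr_chain ordered_bratteli_kr_bratteli by (auto simp: bratteli_equiv_def)
qed

end

lemma cantor_space_compact: "cantor_space X \<Longrightarrow> compact_space X"
  unfolding cantor_space_def
  using homeomorphic_compact_space compact_space_product_topology compact_space_discrete_topology
  by (metis finite)


theorem theorem3p9:
  fixes X :: "'a topology" and U V :: "'a set" and h :: "'a \<Rightarrow> 'a"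
    and P Q :: "nat \<Rightarrow> 'a kr"
  assumes "cantor_space X"
    and "openin X U" and "openin X V"
    and "topspace X - U \<noteq> {}" and "finite (topspace X - U)"
    and "topspace X - V \<noteq> {}" and "finite (topspace X - V)"
    and "(topspace X - U) \<inter> (topspace X - V) = {}"
    and "homeomorphic_map (subtopology X U) (subtopology X V) h"
    and "minimal X U V h"
    and "admissible X U V h P" and "admissible X U V h Q"
  shows "bratteli_equiv (kr_bratteli P) (kr_bratteli Q)"
proof -
  have "inj_on h (topspace (subtopology X U))"
    using assms(9) homeomorphic_eq_everything_map by blast
  moreover have "topspace (subtopology X U) = U"
    using assms(2) openin_subset by force
  ultimately interpret partial_injection X U V h
    by unfold_locales simp
  show ?thesis
    using bratteli_equiv_admissible cantor_space_compact assms(1,11,12) by blast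
qed

end
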